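(* Let $\Omega\subset\mathbb{R}^2$ be a bounded domain with $C^3$ boundary. Then there exist $\overline{\delta}>0$ and a constant $C>0$ (independent of $\delta$ and $\mathbf{x}$) such that for every $0<\delta\le\overline{\delta}$ and every $\mathbf{x}\in\mathcal{I}\Omega_N$ the matrix $$\mathbf{A}(\mathbf{x}):=\frac{d}{m(\delta)}\int_{B_\delta(\mathbf{x})\cap\Omega}K(|\mathbf{y}-\mathbf{x}|)\,(\mathbf{y}-\mathbf{x})\otimes(\mathbf{y}-\mathbf{x})\,d\mathbf{y}$$ is invertible, so that the correction tensor $\mathbf{M}(\mathbf{x})=\mathbf{A}(\mathbf{x})^{-1}$ is a well-defined symmetric matrix. Moreover, writing matrices in the orthonormal basis $(\mathbf{p},\mathbf{n})=(\mathbf{p}(\overline{\mathbf{x}}),\mathbf{n}(\overline{\mathbf{x}}))$, with $$a_{pp}=\frac{d}{m(\delta)}\int_{B_\delta(\mathbf{x})\cap\Omega}K\,((\mathbf{y}-\mathbf{x})\cdot\mathbf{p})^2d\mathbf{y},\quad a_{nn}=\frac{d}{m(\delta)}\int_{B_\delta(\mathbf{x})\cap\Omega}K\,((\mathbf{y}-\mathbf{x})\cdot\mathbf{n})^2d\mathbf{y},$$ $$a_{pn}=\frac{d}{m(\delta)}\int_{B_\delta(\mathbf{x})\cap\Omega}K\,((\mathbf{y}-\mathbf{x})\cdot\mathbf{p})((\mathbf{y}-\mathbf{x})\cdot\mathbf{n})d\mathbf{y},$$ one has $|a_{pn}|\le C\delta^2$, and $$\mathbf{M}(\mathbf{x})=\begin{pmatrix}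 a_{pp}^{-1}+O(\delta^4) & O(\delta^2)\\ O(\delta^2) & a_{nn}^{-1}+O(\delta^4)\end{pmatrix},$$ where each $O(\delta^k)$ denotes a quantity bounded in absolute value by $C\delta^k$.
   Context: Dimension $d=2$. For a horizon $\delta>0$, $B_\delta(\mathbf{x})$ is the ball of radius $\delta$ centered at $\mathbf{x}$. The kernel is $K(r)=1/r$ for $0<r\le\delta$ and $K(r)=0$ for $r>\delta$; we write $K$ for $K(|\mathbf{y}-\mathbf{x}|)$. The weighted volume is $m(\delta)=\int_{B_\delta(\mathbf{x})}K(|\mathbf{y}-\mathbf{x}|)|\mathbf{y}-\mathbf{x}|^2d\mathbf{y}=2\pi\delta^3/3$. The boundary is split as $\partial\Omega=\partial\Omega_D\cup\partial\Omega_N$ with disjoint relative interiors (both are curves). $\mathcal{I}\Omega_N:=\{\mathbf{x}\in\Omega:\operatorname{dist}(\mathbf{x},\partial\Omega_N)<\delta\}$. It is assumed $\delta$ is small enough that each $\mathbf{x}\in\mathcal{I}\Omega_N$ has a unique orthogonal projection $\overline{\mathbf{x}}$ onto $\partial\Omega_N$, with $\overline{\mathbf{x}}-\mathbf{x}=s_x\mathbf{n}(\overline{\mathbf{x}})$, $0<s_x<\delta$; $\mathbf{n}(\overline{\mathbf{x}})$ is the outward unit normal and $\mathbf{p}(\overline{\mathbf{x}})$ the unit tangent at $\overline{\mathbf{x}}$. *)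

theory Defs
  imports "HOL-Analysis.Analysis"
begin

definition C3_on :: "real set \<Rightarrow> (real \<Rightarrow> real) \<Rightarrow> bool" where
  "C3_on S g \<longleftrightarrow> (\<exists>g1 g2 g3.
      (\<forall>t\<in>S. (g has_real_derivative g1 t) (at t)) \<and>
      (\<forall>t\<in>S. (g1 has_real_derivative g2 t) (at t)) \<and>
      (\<forall>t\<in>S. (g2 has_real_derivative g3 t) (at t)) \<and>
      continuous_on S g3)"

definition C3_chart :: "(real^2) set \<Rightarrow> real^2 \<Rightarrow> real \<Rightarrow> real^2 \<Rightarrow> real^2 \<Rightarrow> (real \<Rightarrow> real) \<Rightarrow> bool" where
  "C3_chart \<Omega> z r e1 e2 g \<longleftrightarrow>
     r > 0 \<and> norm e1 = 1 \<and> norm e2 = 1 \<and> e1 \<bullet> e2 = 0 \<and> C3_on {-r<..<r} g \<and>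
     (\<forall>y\<in>ball z r. y \<in> \<Omega> \<longleftrightarrow> (y - z) \<bullet> e2 < g ((y - z) \<bullet> e1))"

definition C3_boundary :: "(real^2) set \<Rightarrow> bool" where
  "C3_boundary \<Omega> \<longleftrightarrow> (\<forall>z\<in>frontier \<Omega>. \<exists>r e1 e2 g. C3_chart \<Omega> z r e1 e2 g)"

definition bounded_domain :: "(real^2) set \<Rightarrow> bool" where
  "bounded_domain \<Omega> \<longleftrightarrow> open \<Omega> \<and> connected \<Omega> \<and> bounded \<Omega> \<and> \<Omega> \<noteq> {}"

text \<open>n is the outward unit normal of Omega at the boundary point z
  (normal to the graph of the local chart, pointing away from Omega).\<close>
definition outward_normal :: "(real^2) set \<Rightarrow> real^2 \<Rightarrow> real^2 \<Rightarrow> bool" where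
  "outward_normal \<Omega> z n \<longleftrightarrow> (\<exists>r e1 e2 g d. C3_chart \<Omega> z r e1 e2 g \<and>
      (g has_real_derivative d) (at 0) \<and>
      n = (1 / sqrt (1 + d\<^sup>2)) *\<^sub>R (e2 - d *\<^sub>R e1))"

definition tangent_of :: "real^2 \<Rightarrow> real^2" where
  "tangent_of n = vector [- (n$2), n$1]"

definition kernel :: "real \<Rightarrow> real \<Rightarrow> real" where
  "kernel \<delta> r = (if 0 < r \<and> r \<le> \<delta> then 1 / r else 0)"

definition mvol :: "real \<Rightarrow> real" where
  "mvol \<delta> = 2 * pi * \<delta> ^ 3 / 3"

definition I_Omega_N :: "(real^2) set \<Rightarrow> (real^2) set \<Rightarrow> real \<Rightarrow> (real^2) set" where
  "I_Omega_N \<Omega> \<Gamma>N \<delta> = {x\<in>\<Omega>. infdist x \<Gamma>N < \<delta>}"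

definition Amat :: "(real^2) set \<Rightarrow> real \<Rightarrow> real^2 \<Rightarrow> real^2^2" where
  "Amat \<Omega> \<delta> x = (\<chi> i j. (2 / mvol \<delta>) *
      integral (ball x \<delta> \<inter> \<Omega>) (\<lambda>y. kernel \<delta> (norm (y - x)) * ((y - x) $ i) * ((y - x) $ j)))"

definition acoef :: "(real^2) set \<Rightarrow> real \<Rightarrow> real^2 \<Rightarrow> real^2 \<Rightarrow> real^2 \<Rightarrow> real" where
  "acoef \<Omega> \<delta> x u v = (2 / mvol \<delta>) *
      integral (ball x \<delta> \<inter> \<Omega>) (\<lambda>y. kernel \<delta> (norm (y - x)) * ((y - x) \<bullet> u) * ((y - x) \<bullet> v))"

end

theory Submission
  imports Defs
begin

text \<open>
  In the frame \<open>(p, n)\<close> at the projection of x, the boundary is a parabola \<open>u = \<kappa> t\<^sup>2\<close> up to an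
  error of third order, uniformly in the boundary point by compactness. The part of the ball below
  the parabola is symmetric under \<open>t \<mapsto> -t\<close> while the integrand of \<open>a\<^sub>p\<^sub>n\<close> is odd, so \<open>a\<^sub>p\<^sub>n\<close> only
  sees the strip between parabola and boundary, of area \<open>O(\<delta>\<^sup>4)\<close>; after dividing by \<open>m(\<delta>)\<close> this
  leaves \<open>O(\<delta>\<^sup>2)\<close>. The diagonal entries are bounded below because the domain contains a ball of
  radius \<open>\<delta>/8\<close> away from both axes. The expansion of the inverse is then read off Cramer's rule.
\<close>

section \<open>Third-order Taylor estimates in boundary charts\<close>

text \<open>The sign condition on a chart is turned into one in the rotated frame without the implicit
  function theorem: near the boundary u is quadratically small, so the terms of
  \<open>(\<alpha> t + \<beta> u)\<^sup>2\<close> that contain u are of third order.\<close>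
lemma parabola_estimate:
  fixes w :: real
  assumes "w \<ge> 1" "\<bar>\<alpha>\<bar> \<le> 1" "\<bar>\<beta>\<bar> \<le> 1" "\<bar>q\<bar> \<le> L" "0 \<le> h" "h \<le> 1"
    "\<bar>t\<bar> \<le> h" "\<bar>u\<bar> \<le> h" "\<bar>R\<bar> \<le> L * h^3"
    and \<Phi>: "w * u \<le> q * (\<alpha> * t + \<beta> * u)\<^sup>2 + R"
  shows "u \<le> q * \<alpha>\<^sup>2 / w * t\<^sup>2 + (15 * L\<^sup>2 + L) * h^3"
proof (rule ccontr)
  define \<kappa> where "\<kappa> = q * \<alpha>\<^sup>2 / w"
  assume "\<not> ?thesis"
  then have big: "u > \<kappa> * t\<^sup>2 + (15 * L\<^sup>2 + L) * h^3" by (simp add: \<kappa>_def)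
  have L0: "L \<ge> 0" using assms by linarith
  have h3: "h^3 \<le> h\<^sup>2" using assms by (intro power_decreasing) auto
  have sq1: "\<alpha>\<^sup>2 \<le> 1" "\<beta>\<^sup>2 \<le> 1" using assms by (simp_all add: abs_square_le_1)
  have t2: "t\<^sup>2 \<le> h\<^sup>2" using assms by (simp add: abs_le_square_iff[symmetric])
  have at: "\<bar>\<alpha> * t\<bar> \<le> h" "\<bar>\<beta> * u\<bar> \<le> h"
    using mult_mono[of "\<bar>\<alpha>\<bar>" 1 "\<bar>t\<bar>" h] mult_mono[of "\<bar>\<beta>\<bar>" 1 "\<bar>u\<bar>" h] assms(2,3,5,7,8)
    by (simp_all add: abs_mult)
  have "\<bar>\<kappa>\<bar> \<le> L"
  proof -
    have "\<bar>\<kappa>\<bar> = \<bar>q\<bar> * \<alpha>\<^sup>2 / w" using assms by (simp add: \<kappa>_def abs_mult)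
    also have "\<dots> \<le> \<bar>q\<bar> * \<alpha>\<^sup>2 / 1" using assms by (intro divide_left_mono) auto
    also have "\<dots> = \<bar>q\<bar> * \<alpha>\<^sup>2" by simp
    also have "\<dots> \<le> L * 1" using sq1 assms(4) L0 by (intro mult_mono) auto
    finally show ?thesis by simp
  qed
  then have k2: "\<bar>\<kappa> * t\<^sup>2\<bar> \<le> L * h\<^sup>2"
    using t2 L0 by (simp add: abs_mult mult_mono)
  have ssq: "(\<alpha> * t + \<beta> * u)\<^sup>2 \<le> (2 * h)\<^sup>2"
    using at assms(5) by (intro abs_le_square_iff[THEN iffD1]) auto
  have "q * (\<alpha> * t + \<beta> * u)\<^sup>2 \<le> L * (2*h)\<^sup>2"
    using ssq assms(4) L0 by (intro mult_mono) auto
  moreover have "R \<le> L * h\<^sup>2" using assms(9) h3 L0 mult_left_mono[OF h3 L0] by linarith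
  \<comment> \<open>The 5 is made of 4 from \<open>(2*h)\<^sup>2\<close> and 1 from
    \<open>R\<close>.\<close>
  ultimately have "w * u \<le> 5 * L * h\<^sup>2" using \<Phi> by (simp add: power_mult_distrib)
  moreover have "u \<le> w * u \<or> u < 0" using assms(1) by (cases "u < 0") (auto simp: mult_le_cancel_right1)
  moreover have "0 \<le> L * h\<^sup>2" using L0 by simp
  ultimately have up: "u \<le> 5 * L * h\<^sup>2" by linarith
  have "0 \<le> (15 * L\<^sup>2 + L) * h^3" using L0 assms by simp
  \<comment> \<open>Arguing by contradiction pays here: the negated claim bounds \<open>u\<close>
    from below, so \<open>u\<close> is of size \<open>h\<^sup>2\<close> on both sides and not just
    of size \<open>h\<close>.\<close>
  with big k2 \<open>0 \<le> L * h\<^sup>2\<close> have "u \<ge> - (5 * L * h\<^sup>2)" by linarith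
  with up have u5: "\<bar>u\<bar> \<le> 5 * L * h\<^sup>2" by linarith
  have b1: "\<bar>2 * (\<alpha>*t) * (\<beta> * u)\<bar> \<le> 2 * h * (5 * L * h\<^sup>2)"
  proof -
    have "\<bar>\<beta> * u\<bar> \<le> 1 * (5 * L * h\<^sup>2)" unfolding abs_mult
      using u5 assms(3) by (intro mult_mono) auto
    then have "\<bar>\<alpha>*t\<bar> * \<bar>\<beta> * u\<bar> \<le> h * (5 * L * h\<^sup>2)"
      using at assms(5) by (intro mult_mono) auto
    then show ?thesis by (simp only: abs_mult abs_numeral mult.assoc)
  qed
  have b2: "\<bar>(\<beta> * u)\<^sup>2\<bar> \<le> h * (5 * L * h\<^sup>2)"
  proof -
    have "\<bar>\<beta> * u\<bar> \<le> 1 * (5 * L * h\<^sup>2)" unfolding abs_mult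
      using u5 assms(3) by (intro mult_mono) auto
    then have "\<bar>\<beta>*u\<bar> * \<bar>\<beta> * u\<bar> \<le> h * (5 * L * h\<^sup>2)"
      using at assms(5) by (intro mult_mono) auto
    then show ?thesis by (simp add: power2_eq_square abs_mult)
  qed
  \<comment> \<open>The cross term contributes two copies of \<open>h * (5 * L * h\<^sup>2)\<close>
    and the square one; this is the source of 15.\<close>
  have "\<bar>q * (2 * (\<alpha>*t) * (\<beta> * u) + (\<beta> * u)\<^sup>2)\<bar> \<le> L * (3 * (h * (5 * L * h\<^sup>2)))"
    unfolding abs_mult[of q]
  proof (rule mult_mono)
    show "\<bar>2 * (\<alpha>*t) * (\<beta> * u) + (\<beta> * u)\<^sup>2\<bar> \<le> 3 * (h * (5 * L * h\<^sup>2))"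
      using b1 b2 by linarith
  qed (use assms(4) L0 in auto)
  then have c: "q * (2 * (\<alpha>*t) * (\<beta> * u) + (\<beta> * u)\<^sup>2) \<le> 15 * L\<^sup>2 * h^3"
    by (simp add: power2_eq_square power3_eq_cube mult.assoc mult.left_commute)
  have "w * (u - \<kappa> * t\<^sup>2) = w * u - q * (\<alpha> * t)\<^sup>2"
    using assms(1) by (simp add: \<kappa>_def field_simps power_mult_distrib)
  also have "\<dots> \<le> q * (2 * (\<alpha>*t) * (\<beta> * u) + (\<beta> * u)\<^sup>2) + R"
    using \<Phi> by (simp add: power2_sum algebra_simps)
  also have "\<dots> \<le> (15 * L\<^sup>2 + L) * h^3" using c assms(9) by (simp add: algebra_simps)
  finally have A: "w * (u - \<kappa> * t\<^sup>2) \<le> (15 * L\<^sup>2 + L) * h^3" .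
  have "u - \<kappa> * t\<^sup>2 > 0" using big \<open>0 \<le> (15 * L\<^sup>2 + L) * h^3\<close> by linarith
  then have "u - \<kappa> * t\<^sup>2 \<le> w * (u - \<kappa> * t\<^sup>2)" using assms(1) by (simp add: mult_le_cancel_right1)
  with A big show False by linarith
qed

text \<open>The Lagrange remainder involves the third derivative, which is bounded, like the second,
  on the compact half interval. The base point \<open>a\<close> is free because the expansion is
  later taken at boundary points near the centre of the chart. The witness for \<open>g2\<close> is
  half the second derivative, the coefficient in the Taylor polynomial.\<close>

lemma C3_on_Taylor:
  assumes "C3_on {-r<..<r} g" "r > 0"
  shows "\<exists>g1 g2 L. L \<ge> 0 \<and> (\<forall>a. \<bar>a\<bar> \<le> r/2 \<longrightarrow> (g has_real_derivative g1 a) (at a) \<and> \<bar>g2 a\<bar> \<le> L) \<and>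
     (\<forall>a b. \<bar>a\<bar> \<le> r/2 \<and> \<bar>b\<bar> \<le> r/2 \<longrightarrow>
        \<bar>g b - g a - g1 a * (b - a) - g2 a * (b - a)\<^sup>2\<bar> \<le> L * \<bar>b - a\<bar>^3)"
proof -
  obtain g1 g2 g3 where g: "\<And>t. t \<in> {-r<..<r} \<Longrightarrow> (g has_real_derivative g1 t) (at t)"
     "\<And>t. t \<in> {-r<..<r} \<Longrightarrow> (g1 has_real_derivative g2 t) (at t)"
     "\<And>t. t \<in> {-r<..<r} \<Longrightarrow> (g2 has_real_derivative g3 t) (at t)"
     and c3: "continuous_on {-r<..<r} g3"
    using assms(1) unfolding C3_on_def by blast
  have sub: "{-(r/2)..r/2} \<subseteq> {-r<..<r}" using assms(2) by auto
  have c2: "continuous_on {-r<..<r} g2"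
    by (rule DERIV_continuous_on[OF has_field_derivative_at_within[OF g(3)]])
  have "bounded (g2 ` {-(r/2)..r/2})" "bounded (g3 ` {-(r/2)..r/2})"
    using continuous_on_subset[OF c2 sub] continuous_on_subset[OF c3 sub]
    by (auto intro!: compact_imp_bounded compact_continuous_image)
  then obtain L2 L3 where L: "\<And>a. a \<in> {-(r/2)..r/2} \<Longrightarrow> \<bar>g2 a\<bar> \<le> L2" "\<And>a. a \<in> {-(r/2)..r/2} \<Longrightarrow> \<bar>g3 a\<bar> \<le> L3"
    unfolding bounded_iff real_norm_def by (meson imageI)
  define L where "L = max L2 L3"
  have Lb: "\<bar>g2 a\<bar> \<le> L" "\<bar>g3 a\<bar> \<le> L" if "\<bar>a\<bar> \<le> r/2" for a
    using L[of a] abs_le_D1[OF that] abs_le_D2[OF that] by (auto simp: L_def le_max_iff_disj)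
  have L0: "L \<ge> 0" using Lb(1)[of 0] assms(2) by auto
  have T: "\<bar>g b - g a - g1 a * (b - a) - (g2 a / 2) * (b - a)\<^sup>2\<bar> \<le> L * \<bar>b - a\<bar>^3"
    if ab: "\<bar>a\<bar> \<le> r/2" "\<bar>b\<bar> \<le> r/2" for a b
  proof (cases "a = b")
    case False
    define diff where "diff = (\<lambda>m::nat. if m = 0 then g else if m = 1 then g1 else if m = 2 then g2 else g3)"
    have "\<exists>t. (if b < a then b < t \<and> t < a else a < t \<and> t < b) \<and>
       g b = (\<Sum>m<3. diff m a / fact m * (b - a) ^ m) + diff 3 t / fact 3 * (b - a) ^ 3"
    proof (rule Taylor[where a = "-(r/2)" and b = "r/2"])
      show "\<forall>m t. m < 3 \<and> - (r / 2) \<le> t \<and> t \<le> r / 2 \<longrightarrow> DERIV (diff m) t :> diff (Suc m) t"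
      proof (intro allI impI)
        fix m :: nat and t assume *: "m < 3 \<and> - (r / 2) \<le> t \<and> t \<le> r / 2"
        then have "t \<in> {-r<..<r}" using assms(2) by auto
        from g[OF this] * show "DERIV (diff m) t :> diff (Suc m) t"
          by (cases "m = 0"; cases "m = 1"; cases "m = 2") (auto simp: diff_def)
      qed
    qed (use ab False in \<open>auto simp: diff_def\<close>)
    then obtain t where t: "if b < a then b < t \<and> t < a else a < t \<and> t < b"
      "g b = (\<Sum>m<3. diff m a / fact m * (b - a) ^ m) + diff 3 t / fact 3 * (b - a) ^ 3" by blast
    have tb: "\<bar>t\<bar> \<le> r/2" using t(1) ab by (auto split: if_splits)
    have "g b - g a - g1 a * (b - a) - (g2 a / 2) * (b - a)\<^sup>2 = g3 t / 6 * (b - a)^3"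
      using t(2) by (simp add: diff_def eval_nat_numeral)
    also have "\<bar>\<dots>\<bar> = \<bar>g3 t\<bar> / 6 * \<bar>b - a\<bar>^3" by (simp add: abs_mult power_abs)
    also have "\<dots> \<le> L * \<bar>b - a\<bar>^3" using Lb(2)[OF tb] L0 by (intro mult_right_mono) auto
    finally show ?thesis .
  qed simp
  have "\<forall>a. \<bar>a\<bar> \<le> r/2 \<longrightarrow> (g has_real_derivative g1 a) (at a) \<and> \<bar>g2 a / 2\<bar> \<le> L"
  proof (intro allI impI conjI)
    fix a assume a: "\<bar>a\<bar> \<le> r/2"
    show "(g has_real_derivative g1 a) (at a)" using a assms(2) by (intro g) auto
    show "\<bar>g2 a / 2\<bar> \<le> L" using Lb(1)[OF a] by simp
  qed
  with L0 T show ?thesis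
    by (intro exI[where x = g1] exI[where x = "\<lambda>a. g2 a / 2"] exI[where x = L] conjI) auto
qed

text \<open>A chart describes \<Omega> itself, so its frontier has to be located. A frontier point
  is not in the open set, hence not below the graph. The points of the chart ball strictly above the
  graph form an open set that misses \<Omega>, hence also its closure.\<close>

lemma frontier_point_on_graph:
  assumes "open \<Omega>" "C3_chart \<Omega> z0 r e1 e2 g" "z \<in> frontier \<Omega>" "z \<in> ball z0 r"
  shows "(z - z0) \<bullet> e2 = g ((z - z0) \<bullet> e1)"
proof -
  have ch: "\<And>y. y \<in> ball z0 r \<Longrightarrow> y \<in> \<Omega> \<longleftrightarrow> (y - z0) \<bullet> e2 < g ((y - z0) \<bullet> e1)"
    and e1: "norm e1 = 1"
    and C3: "C3_on {-r<..<r} g" using assms(2) unfolding C3_chart_def by auto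
  have cg: "continuous_on {-r<..<r} g" using C3 unfolding C3_on_def
    by (blast intro: DERIV_continuous_on has_field_derivative_at_within)
  have in_I: "(y - z0) \<bullet> e1 \<in> {-r<..<r}" if "y \<in> ball z0 r" for y
    using Cauchy_Schwarz_ineq2[of "y - z0" e1] that e1 by (auto simp: dist_norm norm_minus_commute)
  have cont: "continuous_on (ball z0 r) (\<lambda>y. (y - z0) \<bullet> e2 - g ((y - z0) \<bullet> e1))"
    using in_I by (intro continuous_intros continuous_on_compose2[OF cg]) auto
  have "z \<notin> \<Omega>" "z \<in> closure \<Omega>" using assms(1,3) by (auto simp: frontier_def interior_open)
  then have ge: "(z - z0) \<bullet> e2 \<ge> g ((z - z0) \<bullet> e1)" using ch assms(4) by force
  define U where "U = ball z0 r \<inter> (\<lambda>y. (y - z0) \<bullet> e2 - g ((y - z0) \<bullet> e1)) -` {0<..}"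
  have "open U" unfolding U_def by (intro continuous_open_preimage cont) auto
  moreover have "U \<inter> \<Omega> = {}" using ch by (force simp: U_def)
  ultimately have "U \<inter> closure \<Omega> = {}" by (simp add: open_Int_closure_eq_empty)
  then have "z \<notin> U" using \<open>z \<in> closure \<Omega>\<close> by auto
  with ge assms(4) show ?thesis by (auto simp: U_def)
qed

section \<open>The frame of tangent and normal\<close>

lemma inner_tangent_of_frame:
  fixes n a b :: "real^2"
  assumes "norm n = 1"
  shows "a \<bullet> b = (a \<bullet> tangent_of n) * (b \<bullet> tangent_of n) + (a \<bullet> n) * (b \<bullet> n)"
proof -
  have "n$1 * n$1 + n$2 * n$2 = 1"
    using assms by (simp add: norm_eq_1 inner_vec_def sum_2)
  then have "n$1 * n$1 = 1 - n$2 * n$2" by simp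
  then show ?thesis
    by (simp add: inner_vec_def sum_2 tangent_of_def) algebra
qed

lemma tangent_of_orthonormal:
  fixes n :: "real^2"
  assumes "norm n = 1"
  shows "norm (tangent_of n) = 1" "tangent_of n \<bullet> n = 0" "n \<bullet> tangent_of n = 0"
  using assms by (simp_all add: norm_eq_1 inner_vec_def sum_2 tangent_of_def)

section \<open>Osculating parabolas of the boundary\<close>

text \<open>In the frame of tangent and normal at z, the boundary of the set follows the parabola
  with coefficient \<open>\<kappa>\<close> up to a cubic error, with no claim about points inside that error band.\<close>
definition osculating :: "(real^2) set \<Rightarrow> real^2 \<Rightarrow> real^2 \<Rightarrow> real \<Rightarrow> real \<Rightarrow> real \<Rightarrow> bool" where
  "osculating \<Omega> z n \<rho> C \<kappa> \<longleftrightarrow> \<bar>\<kappa>\<bar> \<le> C \<and> (\<forall>h. norm h < \<rho> \<longrightarrow>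
     (h \<bullet> n < \<kappa> * (h \<bullet> tangent_of n)\<^sup>2 - C * norm h ^ 3 \<longrightarrow> z + h \<in> \<Omega>) \<and>
     (h \<bullet> n > \<kappa> * (h \<bullet> tangent_of n)\<^sup>2 + C * norm h ^ 3 \<longrightarrow> z + h \<notin> \<Omega>))"

lemma osculating_mono:
  assumes "osculating \<Omega> z n \<rho> C \<kappa>" "\<rho>' \<le> \<rho>" "C \<le> C'"
  shows "osculating \<Omega> z n \<rho>' C' \<kappa>"
proof -
  have "C * norm h ^ 3 \<le> C' * norm h ^ 3" for h :: "real^2" using assms by (intro mult_right_mono) auto
  then show ?thesis using assms unfolding osculating_def by (smt (verit))
qed

text \<open>The vector of \<open>outward_normal\<close> with the slope as a parameter, so that it is
  available at points of a chart other than its centre.\<close>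

definition graph_normal :: "real^2 \<Rightarrow> real^2 \<Rightarrow> real \<Rightarrow> real^2" where
  "graph_normal e1 e2 d = (1 / sqrt (1 + d\<^sup>2)) *\<^sub>R (e2 - d *\<^sub>R e1)"

lemma norm_graph_normal:
  assumes "norm e1 = 1" "norm e2 = 1" "e1 \<bullet> e2 = 0"
  shows "norm (graph_normal e1 e2 d) = 1"
proof -
  have "(norm (e2 - d *\<^sub>R e1))\<^sup>2 = 1 + d\<^sup>2"
    using assms by (simp add: power2_norm_eq_inner inner_diff inner_commute norm_eq_1) (simp add: power2_eq_square)
  then have "norm (e2 - d *\<^sub>R e1) = sqrt (1 + d\<^sup>2)" by (simp add: real_sqrt_unique)
  moreover have "sqrt (1 + d\<^sup>2) > 0" by (simp add: add_pos_nonneg)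
  ultimately show ?thesis by (simp add: graph_normal_def)
qed

text \<open>Radius and constant are shared by all frontier points near the centre, which is what a
  compactness argument can use. The Taylor expansion of \<open>g\<close> at the abscissa of
  \<open>z\<close>, written in the frame at \<open>z\<close>, has the shape required by
  \<open>parabola_estimate\<close>: the linear terms combine to a multiple of the normal coordinate,
  and only the quadratic term mixes both coordinates.\<close>

lemma chart_osculating:
  assumes "open \<Omega>" and chart: "C3_chart \<Omega> z0 r e1 e2 g"
  shows "\<exists>\<rho>>0. \<exists>C. \<forall>z\<in>frontier \<Omega> \<inter> ball z0 \<rho>. \<exists>d. (g has_real_derivative d) (at ((z - z0) \<bullet> e1)) \<and>
           (\<exists>\<kappa>. osculating \<Omega> z (graph_normal e1 e2 d) \<rho> C \<kappa>)"
proof -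
  have ch: "\<And>y. y \<in> ball z0 r \<Longrightarrow> y \<in> \<Omega> \<longleftrightarrow> (y - z0) \<bullet> e2 < g ((y - z0) \<bullet> e1)"
    and e: "norm e1 = 1" "norm e2 = 1" "e1 \<bullet> e2 = 0" and r: "r > 0"
    and C3: "C3_on {-r<..<r} g" using assms(2) unfolding C3_chart_def by auto
  obtain g1 g2 L where L0: "L \<ge> 0"
    and g: "\<And>a. \<bar>a\<bar> \<le> r/2 \<Longrightarrow> (g has_real_derivative g1 a) (at a)" "\<And>a. \<bar>a\<bar> \<le> r/2 \<Longrightarrow> \<bar>g2 a\<bar> \<le> L"
    and T: "\<And>a b. \<bar>a\<bar> \<le> r/2 \<Longrightarrow> \<bar>b\<bar> \<le> r/2 \<Longrightarrow>
        \<bar>g b - g a - g1 a * (b - a) - g2 a * (b - a)\<^sup>2\<bar> \<le> L * \<bar>b - a\<bar>^3"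
    using C3_on_Taylor[OF C3 r] by blast
  \<comment> \<open>With \<open>r/4\<close>, the abscissas of \<open>z\<close> and
    \<open>z + h\<close> stay in the half interval of the Taylor bound. The 1 provides
    \<open>h \<le> 1\<close> in \<open>parabola_estimate\<close>, whose constant is
    \<open>C\<close>.\<close>
  define \<rho> where "\<rho> = min 1 (r/4)"
  have \<rho>: "0 < \<rho>" "\<rho> \<le> 1" "\<rho> \<le> r/4" using r by (auto simp: \<rho>_def)
  define C where "C = 15 * L\<^sup>2 + L"
  have osc: "\<exists>\<kappa>. osculating \<Omega> z (graph_normal e1 e2 d) \<rho> C \<kappa>"
    if z: "z \<in> frontier \<Omega>" "z \<in> ball z0 \<rho>" and d: "d = g1 ((z - z0) \<bullet> e1)" for z d
  proof -
    define a where "a = (z - z0) \<bullet> e1"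
    define n where "n = graph_normal e1 e2 d"
    define p where "p = tangent_of n"
    define w where "w = sqrt (1 + d\<^sup>2)"
    define \<alpha> where "\<alpha> = e1 \<bullet> p"
    define \<beta> where "\<beta> = e1 \<bullet> n"
    define q where "q = g2 a"
    have w1: "w \<ge> 1" by (simp add: w_def)
    have nn: "norm n = 1" using norm_graph_normal e n_def by auto
    have np: "norm p = 1" using tangent_of_orthonormal(1)[OF nn] by (simp add: p_def)
    have wn: "w * (h \<bullet> n) = h \<bullet> e2 - d * (h \<bullet> e1)" for h
      using w1 by (simp add: n_def graph_normal_def w_def[symmetric] inner_diff_right)
    have ab: "\<bar>\<alpha>\<bar> \<le> 1" "\<bar>\<beta>\<bar> \<le> 1"
      using Cauchy_Schwarz_ineq2[of e1 p] Cauchy_Schwarz_ineq2[of e1 n] e nn np by (auto simp: \<alpha>_def \<beta>_def)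
    have nz: "norm (z - z0) < \<rho>" using z(2) by (simp add: dist_norm norm_minus_commute)
    have a4: "\<bar>a\<bar> \<le> r/4" using Cauchy_Schwarz_ineq2[of "z - z0" e1] nz \<rho> e by (simp add: a_def)
    have zg: "(z - z0) \<bullet> e2 = g a"
      using frontier_point_on_graph[OF assms z(1)] nz \<rho> r by (simp add: a_def dist_norm norm_minus_commute)
    have q: "\<bar>q\<bar> \<le> L" using g(2)[of a] a4 r by (simp add: q_def)
    have key: "\<exists>R. \<bar>R\<bar> \<le> L * norm h^3 \<and> (z + h \<in> \<Omega> \<longleftrightarrow> w * (h \<bullet> n) < q * (\<alpha> * (h \<bullet> p) + \<beta> * (h \<bullet> n))\<^sup>2 + R)"
      if h: "norm h < \<rho>" for h
    proof -
      define \<tau> where "\<tau> = h \<bullet> e1"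
      have \<tau>h: "\<bar>\<tau>\<bar> \<le> norm h" using Cauchy_Schwarz_ineq2[of h e1] e by (simp add: \<tau>_def)
      have \<tau>: "\<tau> = \<alpha> * (h \<bullet> p) + \<beta> * (h \<bullet> n)"
        using inner_tangent_of_frame[OF nn, of h e1] by (simp add: \<tau>_def \<alpha>_def \<beta>_def p_def mult.commute)
      define R where "R = g (a + \<tau>) - g a - d * \<tau> - q * \<tau>\<^sup>2"
      have "\<bar>a + \<tau>\<bar> \<le> r/2" using a4 \<tau>h h \<rho> by linarith
      then have "\<bar>R\<bar> \<le> L * \<bar>\<tau>\<bar>^3"
        using T[of a "a + \<tau>"] a4 r by (simp add: R_def d a_def[symmetric] q_def)
      also have "\<dots> \<le> L * norm h^3" using \<tau>h L0 by (intro mult_left_mono power_mono) auto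
      finally have R: "\<bar>R\<bar> \<le> L * norm h^3" .
      have "norm (z + h - z0) \<le> norm (z - z0) + norm h" by norm
      then have "z + h \<in> ball z0 r" using nz h \<rho> r by (simp add: dist_norm norm_minus_commute)
      from ch[OF this] have "z + h \<in> \<Omega> \<longleftrightarrow> g a + h \<bullet> e2 < g (a + \<tau>)"
        unfolding zg[symmetric] by (simp add: a_def \<tau>_def inner_add_left inner_diff_left algebra_simps)
      also have "\<dots> \<longleftrightarrow> w * (h \<bullet> n) < q * \<tau>\<^sup>2 + R" by (simp add: wn R_def \<tau>_def[symmetric]) linarith
      finally show ?thesis using R \<tau> by auto
    qed
    \<comment> \<open>As \<open>\<alpha>\<^sup>2 = 1 / w\<^sup>2\<close> and \<open>q\<close> is the
      quadratic Taylor coefficient, this is half the signed curvature of the graph.\<close>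
    define \<kappa> where "\<kappa> = q * \<alpha>\<^sup>2 / w"
    have "\<bar>\<kappa>\<bar> \<le> C"
    proof -
      have "\<bar>\<kappa>\<bar> = \<bar>q\<bar> * \<alpha>\<^sup>2 / w" using w1 by (simp add: \<kappa>_def abs_mult)
      also have "\<dots> \<le> \<bar>q\<bar> * \<alpha>\<^sup>2 / 1" using w1 by (intro divide_left_mono) auto
      also have "\<dots> = \<bar>q\<bar> * \<alpha>\<^sup>2" by simp
      also have "\<dots> \<le> L * 1" using ab q L0 by (intro mult_mono) (auto simp: abs_square_le_1)
      finally show ?thesis by (simp add: C_def add_increasing)
    qed
    moreover have "z + h \<in> \<Omega>" if h: "norm h < \<rho>" and u: "h \<bullet> n < \<kappa> * (h \<bullet> p)\<^sup>2 - C * norm h ^ 3" for h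
    proof (rule ccontr)
      assume "z + h \<notin> \<Omega>"
      with key[OF h] obtain R where R: "\<bar>R\<bar> \<le> L * norm h^3"
         "w * (h \<bullet> n) \<ge> q * (\<alpha> * (h \<bullet> p) + \<beta> * (h \<bullet> n))\<^sup>2 + R" by force
      \<comment> \<open>Points outside \<Omega> reduce to the same estimate by reversing the normal:
        \<open>u\<close>, \<open>q\<close>, \<open>R\<close> and \<open>\<beta>\<close> change sign,
        and the argument of the square does not.\<close>
      have "- (h \<bullet> n) \<le> (-q) * \<alpha>\<^sup>2 / w * (h \<bullet> p)\<^sup>2 + (15 * L\<^sup>2 + L) * norm h^3"
        using R Cauchy_Schwarz_ineq2[of h p] Cauchy_Schwarz_ineq2[of h n] h \<rho> nn np
        by (intro parabola_estimate[where R = "-R" and \<beta> = "-\<beta>"] w1) (use q ab in auto)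
      with u show False by (simp add: C_def \<kappa>_def)
    qed
    moreover have "z + h \<notin> \<Omega>" if h: "norm h < \<rho>" and u: "h \<bullet> n > \<kappa> * (h \<bullet> p)\<^sup>2 + C * norm h ^ 3" for h
    proof
      assume "z + h \<in> \<Omega>"
      with key[OF h] obtain R where R: "\<bar>R\<bar> \<le> L * norm h^3"
         "w * (h \<bullet> n) \<le> q * (\<alpha> * (h \<bullet> p) + \<beta> * (h \<bullet> n))\<^sup>2 + R" by force
      have "(h \<bullet> n) \<le> q * \<alpha>\<^sup>2 / w * (h \<bullet> p)\<^sup>2 + (15 * L\<^sup>2 + L) * norm h^3"
        using R Cauchy_Schwarz_ineq2[of h p] Cauchy_Schwarz_ineq2[of h n] h \<rho> nn np
        by (intro parabola_estimate[where R = "R" and \<beta> = "\<beta>"] w1) (use q ab in auto)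
      with u show False by (simp add: C_def \<kappa>_def)
    qed
    ultimately show ?thesis unfolding osculating_def n_def p_def by blast
  qed
  have "\<exists>d. (g has_real_derivative d) (at ((z - z0) \<bullet> e1)) \<and>
           (\<exists>\<kappa>. osculating \<Omega> z (graph_normal e1 e2 d) \<rho> C \<kappa>)" if z: "z \<in> frontier \<Omega> \<inter> ball z0 \<rho>" for z
  proof -
    have "\<bar>(z - z0) \<bullet> e1\<bar> \<le> r/2" using Cauchy_Schwarz_ineq2[of "z - z0" e1] z \<rho> e r
      by (simp add: dist_norm norm_minus_commute)
    then show ?thesis using z g(1) osc by blast
  qed
  then show ?thesis using \<rho>(1) by blast
qed

section \<open>Uniqueness of the normal and uniformity along the boundary\<close>

text \<open>Different unit normals leave a direction \<open>v = n' - n\<close> that points strictly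
  inward for \<open>n\<close> and strictly outward for \<open>n'\<close>. Along it the quadratic and
  cubic corrections are negligible, so \<open>z + t *\<^sub>R v\<close> would lie both inside and
  outside \<Omega> for small positive \<open>t\<close>.\<close>

lemma osculating_normal_unique:
  assumes o: "osculating \<Omega> z n \<rho> C \<kappa>" "osculating \<Omega> z n' \<rho>' C' \<kappa>'" and "\<rho> > 0" "\<rho>' > 0"
   and n: "norm n = 1" "norm n' = 1"
  shows "n = n'"
proof (rule ccontr)
  assume ne: "n \<noteq> n'"
  have lt: "n \<bullet> n' < 1"
  proof -
    have "0 < (n - n') \<bullet> (n - n')" using ne by simp
    then show ?thesis using n by (simp add: inner_diff inner_commute norm_eq_1)
  qed
  define v where "v = n' - n"
  have v: "v \<bullet> n < 0" "v \<bullet> n' > 0" using lt n by (auto simp: v_def inner_diff inner_commute norm_eq_1)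
  define A where "A = (v \<bullet> tangent_of n)\<^sup>2"
  define A' where "A' = (v \<bullet> tangent_of n')\<^sup>2"
  \<comment> \<open>These are the bounds of \<open>osculating\<close> at
    \<open>t *\<^sub>R v\<close> divided by \<open>t\<close>. Both tend to 0, while
    \<open>v \<bullet> n < 0 < v \<bullet> n'\<close>.\<close>
  have 1: "((\<lambda>t. \<kappa> * (t * A) - C * (t\<^sup>2 * norm v ^ 3)) \<longlongrightarrow> \<kappa> * (0 * A) - C * (0\<^sup>2 * norm v ^ 3)) (at_right 0)"
    by (intro tendsto_intros)
  have 2: "((\<lambda>t. \<kappa>' * (t * A') + C' * (t\<^sup>2 * norm v ^ 3)) \<longlongrightarrow> \<kappa>' * (0 * A') + C' * (0\<^sup>2 * norm v ^ 3)) (at_right 0)"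
    by (intro tendsto_intros)
  have 3: "((\<lambda>t. t * norm v) \<longlongrightarrow> 0 * norm v) (at_right 0)" by (intro tendsto_intros)
  have "\<forall>\<^sub>F t in at_right 0. v \<bullet> n < \<kappa> * (t * A) - C * (t\<^sup>2 * norm v ^ 3)"
    using order_tendstoD(1)[OF 1] v by simp
  moreover have "\<forall>\<^sub>F t in at_right 0. v \<bullet> n' > \<kappa>' * (t * A') + C' * (t\<^sup>2 * norm v ^ 3)"
    using order_tendstoD(2)[OF 2] v by simp
  moreover have "\<forall>\<^sub>F t in at_right 0. t * norm v < min \<rho> \<rho>'"
    using order_tendstoD(2)[OF 3, of "min \<rho> \<rho>'"] assms(3,4) by simp
  moreover have "\<forall>\<^sub>F t in at_right (0::real). t > 0" by (simp add: eventually_at_right_less)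
  ultimately have "\<forall>\<^sub>F t in at_right (0::real). False"
  proof eventually_elim
    case (elim t)
    have h: "norm (t *\<^sub>R v) < \<rho>" "norm (t *\<^sub>R v) < \<rho>'" using elim by auto
    have "t * (v \<bullet> n) < t * (\<kappa> * (t * A) - C * (t\<^sup>2 * norm v ^ 3))" using elim by (intro mult_strict_left_mono) auto
    then have "(t *\<^sub>R v) \<bullet> n < \<kappa> * ((t *\<^sub>R v) \<bullet> tangent_of n)\<^sup>2 - C * norm (t *\<^sub>R v) ^ 3"
      using elim by (simp add: A_def power_mult_distrib algebra_simps power2_eq_square power3_eq_cube)
    then have "z + t *\<^sub>R v \<in> \<Omega>" using o(1) h unfolding osculating_def by blast
    moreover have "t * (v \<bullet> n') > t * (\<kappa>' * (t * A') + C' * (t\<^sup>2 * norm v ^ 3))" using elim by (intro mult_strict_left_mono) auto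
    then have "(t *\<^sub>R v) \<bullet> n' > \<kappa>' * ((t *\<^sub>R v) \<bullet> tangent_of n')\<^sup>2 + C' * norm (t *\<^sub>R v) ^ 3"
      using elim by (simp add: A'_def power_mult_distrib algebra_simps power2_eq_square power3_eq_cube)
    then have "z + t *\<^sub>R v \<notin> \<Omega>" using o(2) h unfolding osculating_def by blast
    ultimately show False by blast
  qed
  then show False by (simp add: trivial_limit_at_right_real)
qed

text \<open>The chart behind \<open>outward_normal\<close> is centred at \<open>z\<close> and may
  differ from the one used in a covering of the boundary. A parabola for it, even with a radius
  depending on \<open>z\<close>, lets \<open>osculating_normal_unique\<close> compare the two
  normals.\<close>

lemma outward_normal_osculating:
  assumes "open \<Omega>" "z \<in> frontier \<Omega>" "outward_normal \<Omega> z n"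
  shows "norm n = 1" "\<exists>\<rho>>0. \<exists>C \<kappa>. osculating \<Omega> z n \<rho> C \<kappa>"
proof -
  obtain r e1 e2 g d where c: "C3_chart \<Omega> z r e1 e2 g" and d: "(g has_real_derivative d) (at 0)"
    and n: "n = graph_normal e1 e2 d"
    using assms(3) unfolding outward_normal_def graph_normal_def by blast
  show "norm n = 1" using norm_graph_normal c n unfolding C3_chart_def by auto
  obtain \<rho> C where "\<rho> > 0" and 1: "\<And>y. y\<in>frontier \<Omega> \<inter> ball z \<rho> \<Longrightarrow> \<exists>d. (g has_real_derivative d) (at ((y - z) \<bullet> e1)) \<and>
           (\<exists>\<kappa>. osculating \<Omega> y (graph_normal e1 e2 d) \<rho> C \<kappa>)"
    using chart_osculating[OF assms(1) c] by blast
  obtain d' \<kappa> where "(g has_real_derivative d') (at 0)" "osculating \<Omega> z (graph_normal e1 e2 d') \<rho> C \<kappa>"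
    using 1[of z] \<open>\<rho> > 0\<close> assms(2) by auto
  moreover have "d' = d" using DERIV_unique d calculation(1) by blast
  ultimately show "\<exists>\<rho>>0. \<exists>C \<kappa>. osculating \<Omega> z n \<rho> C \<kappa>" using n \<open>\<rho> > 0\<close> by blast
qed

text \<open>Finitely many chart neighbourhoods cover the compact frontier, and the least radius with
  the largest constant serves at every point. The given \<open>n\<close> may stem from any chart at
  \<open>z\<close>; uniqueness equates it with the normal of the covering chart.\<close>

lemma uniform_osculating:
  assumes "open \<Omega>" "bounded \<Omega>" "C3_boundary \<Omega>"
  shows "\<exists>\<rho>>0. \<exists>C>0. \<forall>z\<in>frontier \<Omega>. \<forall>n. outward_normal \<Omega> z n \<longrightarrow> (\<exists>\<kappa>. osculating \<Omega> z n \<rho> C \<kappa>)"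
proof -
  have "\<exists>\<rho> C. \<rho> > 0 \<and> (\<forall>z\<in>frontier \<Omega> \<inter> ball z0 \<rho>. \<forall>n. outward_normal \<Omega> z n \<longrightarrow> (\<exists>\<kappa>. osculating \<Omega> z n \<rho> C \<kappa>))"
    if z0: "z0 \<in> frontier \<Omega>" for z0
  proof -
    obtain r e1 e2 g where c: "C3_chart \<Omega> z0 r e1 e2 g"
      using assms(3) z0 unfolding C3_boundary_def by blast
    obtain \<rho> C where \<rho>: "\<rho> > 0" and 1: "\<And>z. z\<in>frontier \<Omega> \<inter> ball z0 \<rho> \<Longrightarrow> \<exists>d. (g has_real_derivative d) (at ((z - z0) \<bullet> e1)) \<and>
             (\<exists>\<kappa>. osculating \<Omega> z (graph_normal e1 e2 d) \<rho> C \<kappa>)"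
      using chart_osculating[OF assms(1) c] by blast
    have "\<exists>\<kappa>. osculating \<Omega> z n \<rho> C \<kappa>" if z: "z \<in> frontier \<Omega> \<inter> ball z0 \<rho>" and n: "outward_normal \<Omega> z n" for z n
    proof -
      obtain d \<kappa> where o: "osculating \<Omega> z (graph_normal e1 e2 d) \<rho> C \<kappa>" using 1[OF z] by blast
      moreover have "norm (graph_normal e1 e2 d) = 1" using norm_graph_normal c unfolding C3_chart_def by auto
      moreover obtain \<rho>' C' \<kappa>' where "\<rho>' > 0" "osculating \<Omega> z n \<rho>' C' \<kappa>'"
        using outward_normal_osculating(2)[OF assms(1) _ n] z by blast
      moreover have "norm n = 1" using outward_normal_osculating(1)[OF assms(1) _ n] z by blast
      ultimately have "graph_normal e1 e2 d = n" using \<rho> osculating_normal_unique by blast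
      then show ?thesis using o by blast
    qed
    then show ?thesis using \<rho> by blast
  qed
  then obtain \<rho> C where \<rho>: "\<And>z0. z0 \<in> frontier \<Omega> \<Longrightarrow> \<rho> z0 > 0"
    and osc: "\<And>z0 z n. z0 \<in> frontier \<Omega> \<Longrightarrow> z\<in>frontier \<Omega> \<inter> ball z0 (\<rho> z0) \<Longrightarrow> outward_normal \<Omega> z n \<Longrightarrow> (\<exists>\<kappa>. osculating \<Omega> z n (\<rho> z0) (C z0) \<kappa>)"
    by metis
  have "compact (frontier \<Omega>)" using assms(2) by (rule compact_frontier_bounded)
  then obtain D where D: "D \<subseteq> frontier \<Omega>" "finite D" "frontier \<Omega> \<subseteq> (\<Union>z\<in>D. ball z (\<rho> z))"
    by (rule compactE_image[of _ "frontier \<Omega>" "\<lambda>z. ball z (\<rho> z)"]) (use \<rho> in auto)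
  \<comment> \<open>Inserting 1 keeps both sets nonempty when \<open>D\<close> is empty and makes
    \<open>C0\<close> positive, which the chart constants need not be.\<close>
  define \<rho>0 where "\<rho>0 = Min (insert 1 (\<rho> ` D))"
  define C0 where "C0 = Max (insert 1 (C ` D))"
  have "\<rho>0 > 0" using D \<rho> by (auto simp: \<rho>0_def)
  moreover have "C0 > 0" using D by (simp add: C0_def Max_gr_iff)
  moreover have "\<exists>\<kappa>. osculating \<Omega> z n \<rho>0 C0 \<kappa>" if z: "z \<in> frontier \<Omega>" and n: "outward_normal \<Omega> z n" for z n
  proof -
    obtain z0 where "z0 \<in> D" "z \<in> ball z0 (\<rho> z0)" using D z by blast
    moreover have "\<rho>0 \<le> \<rho> z0" "C z0 \<le> C0" using D calculation(1) by (auto simp: \<rho>0_def C0_def)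
    ultimately show ?thesis using osc[of z0 z n] D z n osculating_mono by blast
  qed
  ultimately show ?thesis by blast
qed

section \<open>Frame coordinates and kernel moments\<close>

lemma tangent_frame_expansion:
  fixes n h :: "real^2"
  assumes "norm n = 1"
  shows "h = (h \<bullet> tangent_of n) *\<^sub>R tangent_of n + (h \<bullet> n) *\<^sub>R n"
proof -
  have "h \<bullet> b = ((h \<bullet> tangent_of n) *\<^sub>R tangent_of n + (h \<bullet> n) *\<^sub>R n) \<bullet> b" for b
    using inner_tangent_of_frame[OF assms, of h b] by (simp add: inner_add_left inner_commute[of n b] inner_commute[of "tangent_of n" b])
  then show ?thesis by (metis vector_eq_rdot)
qed

text \<open>The common integrand of \<open>Amat\<close> and \<open>acoef\<close>; free directions
  \<open>u\<close> and \<open>v\<close> cover the coordinate axes and the moving frame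
  alike.\<close>

definition moment :: "real \<Rightarrow> real^2 \<Rightarrow> real^2 \<Rightarrow> real^2 \<Rightarrow> real^2 \<Rightarrow> real" where
  "moment \<delta> x u v y = kernel \<delta> (norm (y - x)) * ((y - x) \<bullet> u) * ((y - x) \<bullet> v)"

lemma moment_measurable: "moment \<delta> x u v \<in> borel_measurable borel"
  unfolding moment_def kernel_def by measurable

text \<open>The singularity 1/r cancels against the two inner products, each at most r, and leaves
  r, which is at most \<delta>. Outside the support, in particular at \<open>y = x\<close>, the
  kernel takes its default value 0.\<close>

lemma moment_bound:
  assumes "norm u = 1" "norm v = 1" "\<delta> > 0"
  shows "\<bar>moment \<delta> x u v y\<bar> \<le> \<delta>"
proof (cases "0 < norm (y - x) \<and> norm (y - x) \<le> \<delta>")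
  case True
  define N where "N = norm (y - x)"
  have N: "0 < N" "N \<le> \<delta>" using True by (auto simp: N_def)
  have "\<bar>(y - x) \<bullet> u\<bar> * \<bar>(y - x) \<bullet> v\<bar> \<le> N * N"
    using Cauchy_Schwarz_ineq2[of "y - x" u] Cauchy_Schwarz_ineq2[of "y - x" v] assms
    by (intro mult_mono) (auto simp: N_def)
  then have "(1/N) * (\<bar>(y - x) \<bullet> u\<bar> * \<bar>(y - x) \<bullet> v\<bar>) \<le> (1/N) * (N * N)" using N by (intro mult_left_mono) auto
  also have "\<dots> = N" using N by simp
  finally show ?thesis using N True by (simp add: moment_def kernel_def abs_mult N_def)
next
  case False
  then show ?thesis using assms by (auto simp: moment_def kernel_def)
qed

lemma moment_abs_integrable:
  assumes "\<delta> > 0" "S \<in> lmeasurable"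
  shows "moment \<delta> x u v absolutely_integrable_on S"
proof (rule measurable_bounded_by_integrable_imp_absolutely_integrable)
  show "moment \<delta> x u v \<in> borel_measurable (lebesgue_on S)"
    by (intro measurable_restrict_space1 measurable_completion) (simp add: moment_measurable)
  show "S \<in> sets lebesgue" using assms by auto
  show "(\<lambda>_. \<delta> * norm u * norm v) integrable_on S" using assms(2) by (simp add: integrable_on_const)
  show "norm (moment \<delta> x u v y) \<le> \<delta> * norm u * norm v" for y
  proof (cases "u = 0 \<or> v = 0")
    case False
    \<comment> \<open>\<open>moment_bound\<close> asks for unit vectors, and the moment is
      homogeneous in each direction.\<close>
    have "\<bar>moment \<delta> x (u /\<^sub>R norm u) (v /\<^sub>R norm v) y\<bar> \<le> \<delta>"
      using False assms by (intro moment_bound) auto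
    also have "moment \<delta> x (u /\<^sub>R norm u) (v /\<^sub>R norm v) y = moment \<delta> x u v y / (norm u * norm v)"
      by (simp add: moment_def field_simps)
    finally show ?thesis using False by (simp add: field_simps)
  qed (auto simp: moment_def)
qed

lemma acoef_moment: "acoef \<Omega> \<delta> x u v = 2 / mvol \<delta> * integral (ball x \<delta> \<inter> \<Omega>) (moment \<delta> x u v)"
  by (simp add: acoef_def moment_def[abs_def])

lemma Amat_moment: "Amat \<Omega> \<delta> x $ i $ j = acoef \<Omega> \<delta> x (axis i 1) (axis j 1)"
  by (simp add: Amat_def acoef_def cart_eq_inner_axis[symmetric] inner_axis)

text \<open>Bilinearity of the moment. It carries estimates made in the frame \<open>(p, n)\<close>
  over to the matrix, which is written in the standard basis.\<close>

lemma acoef_Amat: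
  assumes "open \<Omega>" "\<delta> > 0"
  shows "acoef \<Omega> \<delta> x u v = u$1 * v$1 * Amat \<Omega> \<delta> x $1$1 + (u$1 * v$2 + u$2 * v$1) * Amat \<Omega> \<delta> x $1$2 + u$2 * v$2 * Amat \<Omega> \<delta> x $2$2"
proof -
  define S where "S = ball x \<delta> \<inter> \<Omega>"
  have S: "S \<in> lmeasurable" unfolding S_def using assms by (intro lmeasurable_open) auto
  define f where "f = (\<lambda>i j. moment \<delta> x (axis i 1) (axis j 1))"
  have int: "f i j integrable_on S" for i j
    using moment_abs_integrable[OF assms(2) S] by (simp add: f_def absolutely_integrable_on_def)
  have "moment \<delta> x u v = (\<lambda>y. u$1 * v$1 * f 1 1 y + (u$1 * v$2 + u$2 * v$1) * f 1 2 y + u$2 * v$2 * f 2 2 y)"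
    by (rule ext) (simp add: f_def moment_def inner_axis inner_vec_def[of _ u] inner_vec_def[of _ v] sum_2 algebra_simps)
  then have "integral S (moment \<delta> x u v) = u$1 * v$1 * integral S (f 1 1) + (u$1 * v$2 + u$2 * v$1) * integral S (f 1 2) + u$2 * v$2 * integral S (f 2 2)"
    by (simp add: integral_add integrable_add int integrable_on_mult_right)
  then show ?thesis
    by (simp add: Amat_moment acoef_moment f_def S_def algebra_simps add_divide_distrib)
qed

lemma Amat_sym: "Amat \<Omega> \<delta> x $ i $ j = Amat \<Omega> \<delta> x $ j $ i"
  by (simp add: Amat_def mult_ac)

section \<open>Inversion of a symmetric 2x2 matrix\<close>

text \<open>\<open>Q\<close> is the bilinear form of \<open>A\<close> and the frame is orthonormal,
  so \<open>D\<close> is the determinant of \<open>A\<close>, and Cramer's rule gives the entries of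
  the inverse in the frame just as in the standard basis.\<close>

lemma symmetric_2x2_inverse:
  fixes A :: "real^2^2" and n :: "real^2"
  assumes sym: "A$1$2 = A$2$1" and nn: "norm n = 1"
    and Q: "\<And>u v. Q u v = u$1 * v$1 * A$1$1 + (u$1 * v$2 + u$2 * v$1) * A$1$2 + u$2 * v$2 * A$2$2"
  defines "p \<equiv> tangent_of n"
  defines "D \<equiv> Q p p * Q n n - (Q p n)\<^sup>2"
  assumes D: "D \<noteq> 0"
  shows "invertible A" "transpose (matrix_inv A) = matrix_inv A"
    "p \<bullet> (matrix_inv A *v p) = Q n n / D" "n \<bullet> (matrix_inv A *v n) = Q p p / D"
    "p \<bullet> (matrix_inv A *v n) = - Q p n / D" "n \<bullet> (matrix_inv A *v p) = - Q p n / D"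
proof -
  have n1: "n$1 * n$1 + n$2 * n$2 = 1"
    using nn by (simp add: norm_eq_1 inner_vec_def sum_2)
  have p: "p$1 = - n$2" "p$2 = n$1" by (simp_all add: p_def tangent_of_def)
  \<comment> \<open>The first factor is the squared determinant of the change of basis to
    \<open>(p, n)\<close>, and equals 1.\<close>
  have "D = (n$1 * n$1 + n$2 * n$2)\<^sup>2 * (A$1$1 * A$2$2 - A$1$2 * A$1$2)"
    unfolding D_def Q p by algebra
  then have Ddet: "D = A$1$1 * A$2$2 - A$1$2 * A$1$2" by (simp add: n1)
  define B :: "real^2^2" where "B = (\<chi> i j. (if i = j then (if i = 1 then A$2$2 else A$1$1) else - A$1$2) / D)"
  have B: "B$1$1 = A$2$2 / D" "B$2$2 = A$1$1 / D" "B$1$2 = - A$1$2 / D" "B$2$1 = - A$1$2 / D"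
    by (simp_all add: B_def)
  have AB: "A ** B = mat 1" "B ** A = mat 1"
    using D Ddet sym by (auto simp: vec_eq_iff matrix_matrix_mult_def sum_2 forall_2 B mat_def field_simps)
  then show inv: "invertible A" unfolding invertible_def by blast
  \<comment> \<open>\<open>matrix_inv\<close> is a choice among two-sided inverses; one exists,
    namely \<open>B\<close>, and two-sided inverses are unique.\<close>
  have "A ** matrix_inv A = mat 1 \<and> matrix_inv A ** A = mat 1"
    unfolding matrix_inv_def by (rule someI_ex) (use AB in blast)
  then have MB: "matrix_inv A = B"
    using AB by (metis matrix_mul_assoc matrix_mul_lid matrix_mul_rid)
  show "transpose (matrix_inv A) = matrix_inv A"
    unfolding MB by (simp add: vec_eq_iff forall_2 transpose_def B)
  show "p \<bullet> (matrix_inv A *v p) = Q n n / D" "n \<bullet> (matrix_inv A *v n) = Q p p / D"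
    "p \<bullet> (matrix_inv A *v n) = - Q p n / D" "n \<bullet> (matrix_inv A *v p) = - Q p n / D"
    unfolding MB inner_vec_def matrix_vector_mult_def Q
    by (simp_all add: sum_2 B p add_divide_distrib diff_divide_distrib algebra_simps)
qed

text \<open>With D the determinant, \<open>b / D - 1 / a = e\<^sup>2 / (a * D)\<close>: the diagonal
  error is quadratic in the off-diagonal entry, which turns a bound of order
  \<open>\<delta>^2\<close> into one of order \<open>\<delta>^4\<close>. The smallness of
  \<open>e\<close> keeps the determinant away from 0.\<close>

lemma inverse_entries_bound:
  fixes a b e :: real
  assumes "a \<ge> c" "b \<ge> c" "c > 0" "e\<^sup>2 \<le> c\<^sup>2 / 2" "\<bar>e\<bar> \<le> E"
  shows "a * b - e\<^sup>2 \<ge> c\<^sup>2/2"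
    "\<bar>b / (a * b - e\<^sup>2) - 1 / a\<bar> \<le> 2 / c^3 * E\<^sup>2" "\<bar>- e / (a * b - e\<^sup>2)\<bar> \<le> 2 / c\<^sup>2 * E"
proof -
  have "a * b \<ge> c * c" using assms by (intro mult_mono) auto
  then show D: "a * b - e\<^sup>2 \<ge> c\<^sup>2/2" using assms(4) by (simp add: power2_eq_square)
  define D where "D = a * b - e\<^sup>2"
  have c2: "c\<^sup>2/2 > 0" using assms by simp
  have D0: "D \<ge> c\<^sup>2/2" using D by (simp add: D_def)
  with c2 have "D > 0" by linarith
  note D0 = D0 this
  have "b / D - 1 / a = e\<^sup>2 / (a * D)" using D0 assms by (simp add: field_simps D_def)
  then have "\<bar>b / D - 1 / a\<bar> = e\<^sup>2 / (a * D)" using D0 assms by simp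
  also have "\<dots> \<le> E\<^sup>2 / (c * (c\<^sup>2/2))"
  proof (rule frac_le)
    show "e\<^sup>2 \<le> E\<^sup>2" using assms by (intro abs_le_square_iff[THEN iffD1]) auto
    show "c * (c\<^sup>2/2) \<le> a * D" using assms D0 by (intro mult_mono) auto
  qed (use assms c2 in auto)
  also have "\<dots> = 2 / c^3 * E\<^sup>2" by (simp add: power2_eq_square power3_eq_cube mult_ac)
  finally show "\<bar>b / (a * b - e\<^sup>2) - 1 / a\<bar> \<le> 2 / c^3 * E\<^sup>2" by (simp add: D_def)
  have "\<bar>- e / D\<bar> = \<bar>e\<bar> / D" using D0 by simp
  also have "\<dots> \<le> E / (c\<^sup>2/2)" using assms D0 c2 by (intro frac_le) auto
  finally show "\<bar>- e / (a * b - e\<^sup>2)\<bar> \<le> 2 / c\<^sup>2 * E" by (simp add: D_def mult.commute)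
qed

section \<open>Reflection symmetry and thin strips\<close>

lemma det_reflection:
  fixes p :: "real^2"
  assumes "norm p = 1"
  shows "det (matrix (\<lambda>h. h - (2 * (h \<bullet> p)) *\<^sub>R p)) = -1"
proof -
  have "p$1 * p$1 + p$2 * p$2 = 1" using assms by (simp add: norm_eq_1 inner_vec_def sum_2)
  then show ?thesis
    by (simp add: det_2 matrix_def inner_vec_def sum_2 axis_def) algebra
qed

lemma tangent_reflection:
  fixes n x :: "real^2"
  assumes nn: "norm n = 1"
  defines "p \<equiv> tangent_of n"
  defines "T \<equiv> \<lambda>y. y - (2 * ((y - x) \<bullet> p)) *\<^sub>R p"
  shows "(T y - x) \<bullet> p = - ((y - x) \<bullet> p)" "(T y - x) \<bullet> n = (y - x) \<bullet> n" "norm (T y - x) = norm (y - x)"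
proof -
  have p: "p \<bullet> n = 0" "p \<bullet> p = 1"
    using tangent_of_orthonormal[OF nn] by (auto simp: p_def norm_eq_1)
  show Tx: "(T y - x) \<bullet> p = - ((y - x) \<bullet> p)" "(T y - x) \<bullet> n = (y - x) \<bullet> n"
    using p by (simp_all add: T_def inner_diff_left algebra_simps)
  have "(T y - x) \<bullet> (T y - x) = (y - x) \<bullet> (y - x)"
    using inner_tangent_of_frame[OF nn, of "T y - x" "T y - x"] inner_tangent_of_frame[OF nn, of "y - x" "y - x"]
    by (simp add: p_def[symmetric] Tx)
  then show "norm (T y - x) = norm (y - x)" by (simp add: norm_eq_sqrt_inner)
qed

text \<open>Reflection in the line through \<open>x\<close> along \<open>n\<close> preserves
  \<open>S\<close>, Lebesgue measure and the kernel, but changes the sign of the integrand, so the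
  integral equals its own negative.\<close>

lemma integral_moment_symmetric:
  fixes n :: "real^2"
  assumes "\<delta> > 0" "S \<in> lmeasurable" and nn: "norm n = 1"
  defines "p \<equiv> tangent_of n"
  assumes S: "\<And>y. y \<in> S \<Longrightarrow> y - (2 * ((y - x) \<bullet> p)) *\<^sub>R p \<in> S"
  shows "integral S (moment \<delta> x p n) = 0"
proof -
  define T where "T = (\<lambda>y. y - (2 * ((y - x) \<bullet> p)) *\<^sub>R p)"
  have p: "norm p = 1" using tangent_of_orthonormal[OF nn] by (simp add: p_def)
  have Tx: "(T y - x) \<bullet> p = - ((y - x) \<bullet> p)" "(T y - x) \<bullet> n = (y - x) \<bullet> n" "norm (T y - x) = norm (y - x)" for y
    unfolding T_def p_def by (rule tangent_reflection[OF nn])+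
  have TT: "T (T y) = y" for y
    using Tx(1)[of y] by (simp add: T_def)
  have TS: "T ` S = S"
  proof
    show sub: "T ` S \<subseteq> S" using S by (auto simp: T_def)
    show "S \<subseteq> T ` S" using sub by (metis TT image_eqI image_subset_iff subsetI)
  qed
  have inj: "inj_on T S" by (metis TT inj_onI)
  have odd: "moment \<delta> x p n (T y) = - moment \<delta> x p n y" for y
    by (simp add: moment_def Tx)
  have der: "(T has_derivative (\<lambda>h. h - (2 * (h \<bullet> p)) *\<^sub>R p)) (at y within S)" for y
    unfolding T_def by (auto intro!: derivative_eq_intros)
  \<comment> \<open>The scalar integrand is wrapped in \<open>real^1\<close> to fit the
    vector-valued form of \<open>integral_change_of_variables\<close>.\<close>
  define F :: "real^2 \<Rightarrow> real^1" where "F = (\<lambda>y. vec (moment \<delta> x p n y))"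
  have ai: "F absolutely_integrable_on S"
    using moment_abs_integrable[OF assms(1,2), of x p n]
    by (subst absolutely_integrable_componentwise_iff) (auto simp: F_def Basis_vec_def inner_axis)
  have "integral (T ` S) F = integral S (\<lambda>y. \<bar>det (matrix (\<lambda>h. h - (2 * (h \<bullet> p)) *\<^sub>R p))\<bar> *\<^sub>R F (T y))"
    by (rule integral_change_of_variables) (use assms(2) der inj ai TS in auto)
  also have "\<dots> = integral S (\<lambda>y. - F y)"
    by (rule integral_cong) (simp add: det_reflection[OF p] F_def odd vec_eq_iff)
  also have "\<dots> = - integral S F" by simp
  finally have "integral S F = - integral S F" unfolding TS .
  then have "integral S F $ 1 = 0" by (simp add: vec_eq_iff)
  moreover have "integral S (\<lambda>y. F y $ 1) = integral S F $ 1"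
    using ai by (simp add: integral_component_eq_cart absolutely_integrable_on_def)
  ultimately show ?thesis by (simp add: F_def)
qed

text \<open>The strip is the image of a rectangle under a map with Jacobian determinant -1.\<close>
lemma parabolic_strip_measure:
  fixes n x :: "real^2"
  assumes nn: "norm n = 1" and "\<delta> > 0" "\<epsilon> > 0"
  defines "p \<equiv> tangent_of n"
  shows "\<exists>W. W \<in> lmeasurable \<and> measure lebesgue W \<le> 4 * \<delta> * \<epsilon> \<and>
     (\<forall>y. \<bar>(y - x) \<bullet> p\<bar> \<le> \<delta> \<and> \<bar>(y - x) \<bullet> n - s - \<kappa> * ((y - x) \<bullet> p)\<^sup>2\<bar> \<le> \<epsilon> \<longrightarrow> y \<in> W)"
proof -
  \<comment> \<open>\<open>a$1\<close> is the tangential coordinate and \<open>a$2\<close> the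
    deviation from the parabola along the normal. The derivative is a shear followed by the passage
    to the frame \<open>(p, n)\<close>, which is orthogonal and reverses orientation.\<close>
  define f :: "real^2 \<Rightarrow> real^2" where "f = (\<lambda>a. x + (a$1) *\<^sub>R p + (s + \<kappa> * (a$1)\<^sup>2 + a$2) *\<^sub>R n)"
  define f' :: "real^2 \<Rightarrow> real^2 \<Rightarrow> real^2" where "f' = (\<lambda>a h. (h$1) *\<^sub>R p + (2 * \<kappa> * a$1 * h$1 + h$2) *\<^sub>R n)"
  define B :: "(real^2) set" where "B = cbox (vector [-\<delta>, -\<epsilon>]) (vector [\<delta>, \<epsilon>])"
  have n1: "n$1 * n$1 + n$2 * n$2 = 1" using nn by (simp add: norm_eq_1 inner_vec_def sum_2)
  have p: "p$1 = - n$2" "p$2 = n$1" by (simp_all add: p_def tangent_of_def)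
  have der: "(f has_derivative f' a) (at a within B)" for a
    unfolding f_def f'_def 
    by (auto intro!: derivative_eq_intros bounded_linear.has_derivative[OF bounded_linear_vec_nth] simp: algebra_simps)
  have "det (matrix (f' a)) = -1" for a
    using n1 by (simp add: det_2 matrix_def f'_def axis_def p) algebra
  then have det: "\<bar>det (matrix (f' a))\<bar> = 1" for a by simp
  have meas: "B \<in> lmeasurable" by (simp add: B_def)
  have cB: "measure lebesgue B = 4 * \<delta> * \<epsilon>"
  proof -
    have "B \<noteq> {}" using assms by (auto simp: B_def interval_ne_empty_cart forall_2)
    then show ?thesis unfolding B_def by (simp add: content_cbox_cart UNIV_2)
  qed
  have "f ` B \<in> lmeasurable"
    by (rule measurable_differentiable_image[OF _ der]) (use meas in \<open>auto simp: det integrable_on_const\<close>)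
  moreover have "measure lebesgue (f ` B) \<le> integral B (\<lambda>a. \<bar>det (matrix (f' a))\<bar>)"
    by (rule measure_differentiable_image[OF _ der]) (use meas in \<open>auto simp: det integrable_on_const\<close>)
  then have "measure lebesgue (f ` B) \<le> 4 * \<delta> * \<epsilon>"
    using cB meas by (simp add: det lmeasure_integral)
  moreover have "y \<in> f ` B" if y: "\<bar>(y - x) \<bullet> p\<bar> \<le> \<delta>" "\<bar>(y - x) \<bullet> n - s - \<kappa> * ((y - x) \<bullet> p)\<^sup>2\<bar> \<le> \<epsilon>" for y
  proof (rule image_eqI)
    define a :: "real^2" where "a = vector [(y - x) \<bullet> p, (y - x) \<bullet> n - s - \<kappa> * ((y - x) \<bullet> p)\<^sup>2]"
    show "y = f a" using tangent_frame_expansion[OF nn, of "y - x"] by (simp add: a_def f_def p_def algebra_simps)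
    show "a \<in> B" using abs_le_D1[OF y(1)] abs_le_D2[OF y(1)] abs_le_D1[OF y(2)] abs_le_D2[OF y(2)]
      by (simp add: a_def B_def mem_box_cart forall_2)
  qed
  ultimately show ?thesis by blast
qed

text \<open>Extended by zero, the two integrands differ only on the symmetric difference of
  \<open>S\<close> and \<open>P\<close>, which lies in \<open>W\<close>.\<close>

lemma integral_diff_bound_strip:
  fixes f :: "'a::euclidean_space \<Rightarrow> real"
  assumes f: "f integrable_on S" "f integrable_on P" and W: "W \<in> lmeasurable"
    and b: "\<And>y. \<bar>f y\<bar> \<le> B" and sub: "S - P \<subseteq> W" "P - S \<subseteq> W"
  shows "\<bar>integral S f - integral P f\<bar> \<le> B * measure lebesgue W"
proof -
  define F where "F = (\<lambda>S y. if y \<in> S then f y else 0)"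
  have i: "F S integrable_on UNIV" "F P integrable_on UNIV"
    using f by (simp_all add: F_def integrable_restrict_UNIV)
  have iW: "(\<lambda>y. if y \<in> W then B else 0) integrable_on UNIV"
    using W by (simp add: integrable_restrict_UNIV integrable_on_const)
  have "integral S f - integral P f = integral UNIV (\<lambda>y. F S y - F P y)"
    using i by (simp add: integral_diff) (simp add: F_def integral_restrict_UNIV)
  also have "norm \<dots> \<le> integral UNIV (\<lambda>y. if y \<in> W then B else 0)"
  proof (rule integral_norm_bound_integral)
    show "norm (F S y - F P y) \<le> (if y \<in> W then B else 0)" for y
      using b[of y] sub by (auto simp: F_def)
  qed (use i iW in \<open>auto intro: integrable_diff\<close>)
  also have "\<dots> = integral W (\<lambda>y. B)" by (simp add: integral_restrict_UNIV)
  also have "\<dots> = B * measure lebesgue W"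
    using W lmeasure_integral[OF W] integral_mult_right[of W B "\<lambda>_. 1"] by simp
  finally show ?thesis by simp
qed

section \<open>Bounds on the mixed and diagonal moments\<close>

text \<open>Within the ball, \<Omega> is compared with the region below the parabola, whose mixed
  moment vanishes. The two differ inside a strip of area at most \<open>32 * C * \<delta>^4\<close>,
  where the integrand is at most \<delta> in absolute value.\<close>

lemma mixed_moment_bound:
  fixes n x :: "real^2"
  assumes "open \<Omega>" and nn: "norm n = 1" and \<delta>: "\<delta> > 0" "2 * \<delta> \<le> \<rho>" and s: "0 < s" "s < \<delta>"
    and osc: "osculating \<Omega> (x + s *\<^sub>R n) n \<rho> C \<kappa>" and C: "C > 0"
  shows "\<bar>integral (ball x \<delta> \<inter> \<Omega>) (moment \<delta> x (tangent_of n) n)\<bar> \<le> 32 * C * \<delta>^5"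
proof -
  define p where "p = tangent_of n"
  have p: "norm p = 1" "p \<bullet> n = 0" "n \<bullet> p = 0" "p \<bullet> p = 1" "n \<bullet> n = 1"
    using tangent_of_orthonormal[OF nn] nn by (auto simp: p_def norm_eq_1)
  define S where "S = ball x \<delta> \<inter> \<Omega>"
  define P where "P = ball x \<delta> \<inter> {y. (y - x) \<bullet> n - s < \<kappa> * ((y - x) \<bullet> p)\<^sup>2}"
  have S: "S \<in> lmeasurable" unfolding S_def using assms by (intro lmeasurable_open) auto
  have "open {y. (y - x) \<bullet> n - s < \<kappa> * ((y - x) \<bullet> p)\<^sup>2}"
    by (intro open_Collect_less continuous_intros)
  then have P: "P \<in> lmeasurable" unfolding P_def by (intro lmeasurable_open) auto
  have P0: "integral P (moment \<delta> x p n) = 0"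
    unfolding p_def
  proof (rule integral_moment_symmetric[OF \<delta>(1) P nn], fold p_def)
    fix y assume y: "y \<in> P"
    define y' where "y' = y - (2 * ((y - x) \<bullet> p)) *\<^sub>R p"
    note e = tangent_reflection[OF nn, where x = x and y = y, folded p_def, folded y'_def]
    show "y' \<in> P" using y e by (simp add: P_def dist_norm norm_minus_commute)
  qed
  \<comment> \<open>The half-height is \<open>C * (2 * \<delta>)^3\<close>: a point of the ball is
    closer than \<delta> to \<open>x\<close>, and \<open>x\<close> lies at distance
    \<open>s < \<delta>\<close> from its projection.\<close>
  obtain W where W: "W \<in> lmeasurable" "measure lebesgue W \<le> 4 * \<delta> * (8 * C * \<delta>^3)"
     "\<And>y. \<bar>(y - x) \<bullet> p\<bar> \<le> \<delta> \<Longrightarrow> \<bar>(y - x) \<bullet> n - s - \<kappa> * ((y - x) \<bullet> p)\<^sup>2\<bar> \<le> 8 * C * \<delta>^3 \<Longrightarrow> y \<in> W"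
    using parabolic_strip_measure[OF nn \<delta>(1), of "8 * C * \<delta>^3" x s \<kappa>] C \<delta>(1) unfolding p_def by auto
  have inW: "y \<in> W" if y: "y \<in> ball x \<delta>" and diff: "\<not> (y \<in> \<Omega> \<longleftrightarrow> (y - x) \<bullet> n - s < \<kappa> * ((y - x) \<bullet> p)\<^sup>2)" for y
  proof (rule W(3))
    have ny: "norm (y - x) < \<delta>" using y by (simp add: dist_norm norm_minus_commute)
    then show "\<bar>(y - x) \<bullet> p\<bar> \<le> \<delta>" using Cauchy_Schwarz_ineq2[of "y - x" p] p by simp
    define h where "h = y - x - s *\<^sub>R n"
    have "norm h \<le> norm (y - x) + norm (s *\<^sub>R n)" unfolding h_def by (rule norm_triangle_ineq4)
    then have h: "norm h < 2 * \<delta>" using ny s nn by simp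
    have "norm h ^ 3 \<le> (2 * \<delta>)^3" using h by (intro power_mono) auto
    then have h3: "C * norm h ^ 3 \<le> 8 * C * \<delta>^3" using C by (simp add: power_mult_distrib)
    have hn: "h \<bullet> n = (y - x) \<bullet> n - s" "h \<bullet> p = (y - x) \<bullet> p" "x + s *\<^sub>R n + h = y"
      using p by (simp_all add: h_def inner_diff_left)
    have "norm h < \<rho>" using h \<delta> by simp
    with osc have "h \<bullet> n < \<kappa> * (h \<bullet> p)\<^sup>2 - C * norm h ^ 3 \<longrightarrow> y \<in> \<Omega>"
      "h \<bullet> n > \<kappa> * (h \<bullet> p)\<^sup>2 + C * norm h ^ 3 \<longrightarrow> y \<notin> \<Omega>"
      unfolding osculating_def p_def using hn(3) by metis+
    then show "\<bar>(y - x) \<bullet> n - s - \<kappa> * ((y - x) \<bullet> p)\<^sup>2\<bar> \<le> 8 * C * \<delta>^3"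
      using diff h3 C unfolding hn(1,2) by (smt (verit) mult_nonneg_nonneg norm_ge_zero zero_le_power)
  qed
  have "\<bar>integral S (moment \<delta> x p n) - integral P (moment \<delta> x p n)\<bar> \<le> \<delta> * measure lebesgue W"
  proof (rule integral_diff_bound_strip)
    show "S - P \<subseteq> W" "P - S \<subseteq> W" using inW unfolding S_def P_def by blast+
    show "\<bar>moment \<delta> x p n y\<bar> \<le> \<delta>" for y using moment_bound p nn \<delta> by blast
  qed (use W moment_abs_integrable[OF \<delta>(1)] S P in \<open>auto simp: absolutely_integrable_on_def\<close>)
  also have "\<dots> \<le> \<delta> * (4 * \<delta> * (8 * C * \<delta>^3))" using W(2) \<delta> by (intro mult_left_mono) auto
  also have "\<dots> = 32 * C * \<delta>^5" by (simp add: eval_nat_numeral)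
  finally show ?thesis by (simp add: P0 S_def p_def[symmetric])
qed

text \<open>On a ball of area \<open>pi * (\<delta>/8)\<^sup>2\<close> the integrand is at least
  \<open>(1/\<delta>) * (\<delta>/4)\<^sup>2 = \<delta>/16\<close> for either direction; elsewhere
  it is nonnegative.\<close>

lemma diagonal_moment_bound:
  fixes n x :: "real^2"
  assumes "open \<Omega>" and nn: "norm n = 1" and \<delta>: "\<delta> > 0" "2 * \<delta> \<le> \<rho>" "\<delta> \<le> 1" "40 * C * \<delta> \<le> 1" and s: "0 < s" "s < \<delta>"
    and osc: "osculating \<Omega> (x + s *\<^sub>R n) n \<rho> C \<kappa>" and C: "C > 0"
    and v: "v = n \<or> v = tangent_of n"
  shows "integral (ball x \<delta> \<inter> \<Omega>) (moment \<delta> x v v) \<ge> pi * \<delta>^3 / 1024"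
proof -
  define p where "p = tangent_of n"
  have p: "norm p = 1" "p \<bullet> n = 0" "n \<bullet> p = 0" "p \<bullet> p = 1" "n \<bullet> n = 1"
    using tangent_of_orthonormal[OF nn] nn by (auto simp: p_def norm_eq_1)
  define S where "S = ball x \<delta> \<inter> \<Omega>"
  have S: "S \<in> lmeasurable" unfolding S_def using assms by (intro lmeasurable_open) auto
  \<comment> \<open>The ball around c lies in the quadrant facing away from the boundary, so it stays inside the
    domain, and both frame coordinates of its points have size at least \<open>\<delta>/4\<close>.\<close>
  define c where "c = x + (3/8 * \<delta>) *\<^sub>R (p - n)"
  define B where "B = ball c (\<delta>/8)"
  have B: "B \<in> lmeasurable" by (simp add: B_def)
  have key: "y \<in> S \<and> \<delta> / 16 \<le> moment \<delta> x v v y" if y: "y \<in> B" for y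
  proof -
    define t where "t = (y - x) \<bullet> p"
    define u where "u = (y - x) \<bullet> n"
    have nc: "norm (y - c) < \<delta>/8" using y by (simp add: B_def dist_norm norm_minus_commute)
    have tc: "(y - c) \<bullet> p = t - 3/8 * \<delta>" "(y - c) \<bullet> n = u + 3/8 * \<delta>"
      using p by (simp_all add: c_def t_def u_def inner_diff_left inner_add_left algebra_simps)
    have "\<bar>t - 3/8 * \<delta>\<bar> < \<delta>/8" "\<bar>u + 3/8 * \<delta>\<bar> < \<delta>/8"
      using Cauchy_Schwarz_ineq2[of "y - c" p] Cauchy_Schwarz_ineq2[of "y - c" n] nc p nn
      unfolding tc by auto
    then have tu: "\<delta>/4 < t" "t < \<delta>/2" "-(\<delta>/2) < u" "u < -(\<delta>/4)" by linarith+
    have t2: "t\<^sup>2 \<le> (\<delta>/2)\<^sup>2" "(\<delta>/4)\<^sup>2 \<le> t\<^sup>2" using tu \<delta> by (auto intro!: power_mono)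
    have u2: "u\<^sup>2 \<le> (\<delta>/2)\<^sup>2" "(\<delta>/4)\<^sup>2 \<le> u\<^sup>2" using tu \<delta> by (auto intro!: abs_le_square_iff[THEN iffD1])
    have ny2: "(norm (y - x))\<^sup>2 = t\<^sup>2 + u\<^sup>2"
      using inner_tangent_of_frame[OF nn, of "y - x" "y - x"]
      unfolding power2_norm_eq_inner by (simp add: t_def u_def p_def power2_eq_square)
    have "(norm (y - x))\<^sup>2 < \<delta>\<^sup>2"
    proof -
      have "(\<delta>/2)\<^sup>2 + (\<delta>/2)\<^sup>2 < \<delta>\<^sup>2" using \<delta>(1) by (simp add: power2_eq_square)
      with ny2 t2 u2 show ?thesis by linarith
    qed
    then have ny: "norm (y - x) < \<delta>" using \<delta> by (simp add: power_less_imp_less_base)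
    have nyp: "norm (y - x) > 0" using tu \<delta> by (auto simp: t_def)
    have "y \<in> \<Omega>"
    proof -
      define h where "h = y - x - s *\<^sub>R n"
      have "norm h \<le> norm (y - x) + norm (s *\<^sub>R n)" unfolding h_def by (rule norm_triangle_ineq4)
      then have h: "norm h < 2 * \<delta>" using ny s nn by simp
      have "norm h ^ 3 \<le> (2 * \<delta>)^3" using h by (intro power_mono) auto
      then have "C * norm h ^ 3 \<le> 8 * C * \<delta>^3" using C by (simp add: power_mult_distrib)
      also have "\<dots> \<le> 8 * C * \<delta>\<^sup>2" using C \<delta> by (intro mult_left_mono power_decreasing) auto
      finally have h3: "C * norm h ^ 3 \<le> 8 * C * \<delta>\<^sup>2" .
      have hn: "h \<bullet> n = u - s" "h \<bullet> p = t" "x + s *\<^sub>R n + h = y"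
        using p by (simp_all add: h_def t_def u_def inner_diff_left)
      have "\<bar>\<kappa> * t\<^sup>2\<bar> \<le> C * \<delta>\<^sup>2" unfolding abs_mult
      proof (rule mult_mono)
        show "\<bar>\<kappa>\<bar> \<le> C" using osc by (simp add: osculating_def)
        show "\<bar>t\<^sup>2\<bar> \<le> \<delta>\<^sup>2" using tu \<delta> by (auto intro!: power_mono)
      qed (use C in auto)
      \<comment> \<open>The parabola costs at most \<open>C * \<delta>\<^sup>2\<close> and the cubic
        error \<open>8 * C * \<delta>\<^sup>2\<close>, against \<open>u - s < -(\<delta>/4)\<close>.
        This works once \<open>36 * C * \<delta> < 1\<close>, which the bound with 40
        ensures.\<close>
      moreover have "40 * C * \<delta> * \<delta> \<le> 1 * \<delta>" using \<delta> by (intro mult_right_mono) auto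
      then have "9 * (C * \<delta>\<^sup>2) < \<delta>/4" using \<delta>(1) by (simp add: power2_eq_square)
      ultimately have "h \<bullet> n < \<kappa> * (h \<bullet> p)\<^sup>2 - C * norm h ^ 3"
        unfolding hn using h3 tu s by linarith
      moreover have "norm h < \<rho>" using h \<delta> by simp
      ultimately show "y \<in> \<Omega>" using osc hn(3) unfolding osculating_def p_def by metis
    qed
    then have yS: "y \<in> S" using ny by (simp add: S_def dist_norm norm_minus_commute)
    have "((y - x) \<bullet> v)\<^sup>2 \<ge> (\<delta>/4)\<^sup>2" using v t2 u2 by (auto simp: t_def u_def p_def)
    then have "(1/\<delta>) * (\<delta>/4)\<^sup>2 \<le> (1 / norm (y - x)) * ((y - x) \<bullet> v)\<^sup>2"
      using ny nyp \<delta> by (intro mult_mono frac_le) auto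
    moreover have "(1/\<delta>) * (\<delta>/4)\<^sup>2 = \<delta>/16" using \<delta> by (simp add: power2_eq_square)
    moreover have "moment \<delta> x v v y = (1 / norm (y - x)) * ((y - x) \<bullet> v)\<^sup>2"
      using ny nyp by (simp add: moment_def kernel_def power2_eq_square)
    ultimately show ?thesis using yS by (simp only: simp_thms)
  qed
  have mB: "measure lebesgue B = pi * (\<delta>/8)\<^sup>2"
    using \<delta> by (simp add: B_def content_ball unit_ball_vol_2)
  have "pi * \<delta>^3 / 1024 = \<delta>/16 * measure lebesgue B" by (simp add: mB power2_eq_square power3_eq_cube)
  also have "\<dots> = integral B (\<lambda>y. \<delta>/16)"
    using lmeasure_integral[OF B] integral_mult_right[of B "\<delta>/16" "\<lambda>_. 1"] by simp
  also have "\<dots> \<le> integral B (moment \<delta> x v v)"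
    using key B moment_abs_integrable[OF \<delta>(1) B]
    by (intro integral_le) (auto simp: integrable_on_const absolutely_integrable_on_def)
  also have "\<dots> \<le> integral S (moment \<delta> x v v)"
  proof (rule integral_subset_le)
    show "B \<subseteq> S" using key by blast
    show "\<forall>y\<in>S. 0 \<le> moment \<delta> x v v y" by (simp add: moment_def kernel_def)
  qed (use moment_abs_integrable[OF \<delta>(1)] S B in \<open>auto simp: absolutely_integrable_on_def\<close>)
  finally show ?thesis by (simp add: S_def)
qed

section \<open>Choice of constants and the expansion of the inverse\<close>

theorem theorem1:
  fixes \<Omega> \<Gamma>D \<Gamma>N :: "(real^2) set" and nvec :: "real^2 \<Rightarrow> real^2"
  assumes dom: "bounded_domain \<Omega>"
    and bdry: "C3_boundary \<Omega>"
    and split: "\<Gamma>D \<union> \<Gamma>N = frontier \<Omega>"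
    and normal: "\<forall>z\<in>\<Gamma>N. outward_normal \<Omega> z (nvec z)"
  shows "\<exists>\<delta>bar > 0. \<exists>C > 0. \<forall>\<delta> x xb s.
    0 < \<delta> \<and> \<delta> \<le> \<delta>bar \<and> x \<in> I_Omega_N \<Omega> \<Gamma>N \<delta> \<and> xb \<in> \<Gamma>N \<and>
    0 < s \<and> s < \<delta> \<and> xb - x = s *\<^sub>R nvec xb \<longrightarrow>
      (let A = Amat \<Omega> \<delta> x; M = matrix_inv A; n = nvec xb; p = tangent_of n;
           app = acoef \<Omega> \<delta> x p p; ann = acoef \<Omega> \<delta> x n n; apn = acoef \<Omega> \<delta> x p n
       in invertible A \<and> transpose M = M \<and>
          \<bar>apn\<bar> \<le> C * \<delta>\<^sup>2 \<and>
          \<bar>p \<bullet> (M *v p) - 1 / app\<bar> \<le> C * \<delta> ^ 4 \<and>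
          \<bar>p \<bullet> (M *v n)\<bar> \<le> C * \<delta>\<^sup>2 \<and>
          \<bar>n \<bullet> (M *v p)\<bar> \<le> C * \<delta>\<^sup>2 \<and>
          \<bar>n \<bullet> (M *v n) - 1 / ann\<bar> \<le> C * \<delta> ^ 4)"
proof -
  have op: "open \<Omega>" and bd: "bounded \<Omega>" using dom by (auto simp: bounded_domain_def)
  obtain \<rho> C where \<rho>: "\<rho> > 0" and C: "C > 0" and
    osc: "\<And>z n. z \<in> frontier \<Omega> \<Longrightarrow> outward_normal \<Omega> z n \<Longrightarrow> \<exists>\<kappa>. osculating \<Omega> z n \<rho> C \<kappa>"
    using uniform_osculating[OF op bd bdry] by blast
  \<comment> \<open>\<open>K\<close> and \<open>c\<close> are the constants \<open>32 * C\<close>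
    and \<open>pi / 1024\<close> of the two moment bounds, times \<open>3 / pi\<close> from the
    normalisation \<open>2 / mvol \<delta>\<close>.\<close>
  define K where "K = 96 * C / pi"
  define c :: real where "c = 3 / 1024"
  have K: "K > 0" and c: "c > 0" using C by (auto simp: K_def c_def)
  \<comment> \<open>In order: displacements of length below \<open>2 * \<delta>\<close> fit into the
    radius \<open>\<rho>\<close>, higher powers of \<delta> are smaller, the diagonal bound applies,
    and \<open>K * \<delta>\<^sup>2 \<le> c / 2\<close> makes the mixed entry small against the
    diagonal ones.\<close>
  define \<delta>0 where "\<delta>0 = min (min (\<rho>/2) 1) (min (1 / (40 * C)) (c / (2 * K)))"
  \<comment> \<open>A sum, so that one constant dominates the bounds for the mixed entry, the
    off-diagonal inverse entries and the diagonal errors.\<close>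
  define C' where "C' = K + 2 / c\<^sup>2 * K + 2 / c^3 * K\<^sup>2"
  have C'_ge: "K \<le> C'" "2 / c\<^sup>2 * K \<le> C'" "2 / c^3 * K\<^sup>2 \<le> C'" and C'0: "C' > 0"
    using K c by (auto simp: C'_def add_pos_pos intro: add_pos_nonneg)
  have "\<delta>0 > 0" using \<rho> C K c by (simp add: \<delta>0_def)
  moreover have "let A = Amat \<Omega> \<delta> x; M = matrix_inv A; n = nvec xb; p = tangent_of n;
           app = acoef \<Omega> \<delta> x p p; ann = acoef \<Omega> \<delta> x n n; apn = acoef \<Omega> \<delta> x p n
       in invertible A \<and> transpose M = M \<and>
          \<bar>apn\<bar> \<le> C' * \<delta>\<^sup>2 \<and>
          \<bar>p \<bullet> (M *v p) - 1 / app\<bar> \<le> C' * \<delta> ^ 4 \<and>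
          \<bar>p \<bullet> (M *v n)\<bar> \<le> C' * \<delta>\<^sup>2 \<and>
          \<bar>n \<bullet> (M *v p)\<bar> \<le> C' * \<delta>\<^sup>2 \<and>
          \<bar>n \<bullet> (M *v n) - 1 / ann\<bar> \<le> C' * \<delta> ^ 4"
    if \<delta>: "0 < \<delta>" "\<delta> \<le> \<delta>0" and xb: "xb \<in> \<Gamma>N" and s: "0 < s" "s < \<delta>" "xb - x = s *\<^sub>R nvec xb"
    for \<delta> x xb s
  proof -
    define n where "n = nvec xb"
    define p where "p = tangent_of n"
    define Q where "Q = acoef \<Omega> \<delta> x"
    have fr: "xb \<in> frontier \<Omega>" and on: "outward_normal \<Omega> xb n" using xb split normal by (auto simp: n_def)
    have nn: "norm n = 1" using outward_normal_osculating(1)[OF op fr on] .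
    have xbx: "xb = x + s *\<^sub>R n" using s(3) by (simp add: n_def algebra_simps)
    obtain \<kappa> where \<kappa>: "osculating \<Omega> (x + s *\<^sub>R n) n \<rho> C \<kappa>" using osc[OF fr on] xbx by auto
    have d: "2 * \<delta> \<le> \<rho>" "\<delta> \<le> 1" "40 * C * \<delta> \<le> 1" "2 * K * \<delta> \<le> c"
      using \<delta> C K by (auto simp: \<delta>0_def field_simps)
    have m: "mvol \<delta> > 0" "2 / mvol \<delta> = 3 / (pi * \<delta>^3)" using \<delta> by (simp_all add: mvol_def field_simps)
    have pn: "\<bar>Q p n\<bar> \<le> K * \<delta>\<^sup>2"
    proof -
      have "\<bar>Q p n\<bar> = 3 / (pi * \<delta>^3) * \<bar>integral (ball x \<delta> \<inter> \<Omega>) (moment \<delta> x p n)\<bar>"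
        using \<delta> by (simp add: Q_def acoef_moment m(2) abs_mult)
      also have "\<dots> \<le> 3 / (pi * \<delta>^3) * (32 * C * \<delta>^5)"
        unfolding p_def using mixed_moment_bound[OF op nn \<delta>(1) d(1) s(1,2) \<kappa> C] \<delta> by (intro mult_left_mono) auto
      also have "\<dots> = K * \<delta>\<^sup>2" using \<delta> by (simp add: K_def eval_nat_numeral)
      finally show ?thesis .
    qed
    have diag: "Q v v \<ge> c" if "v = n \<or> v = tangent_of n" for v
    proof -
      have "c = 3 / (pi * \<delta>^3) * (pi * \<delta>^3 / 1024)" using \<delta> by (simp add: c_def)
      also have "\<dots> \<le> Q v v"
        unfolding Q_def acoef_moment m(2)
        using diagonal_moment_bound[OF op nn \<delta>(1) d(1-3) s(1,2) \<kappa> C that] \<delta> by (intro mult_left_mono) auto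
      finally show ?thesis .
    qed
    have nd: "Q n n \<ge> c" "Q p p \<ge> c" using diag by (auto simp: p_def)
    have "K * \<delta>\<^sup>2 \<le> K * \<delta>" using K \<delta> d(2) by (intro mult_left_mono) (auto simp: power2_eq_square)
    then have "\<bar>Q p n\<bar> \<le> \<bar>c / 2\<bar>" using pn d(4) c by linarith
    then have "(Q p n)\<^sup>2 \<le> (c / 2)\<^sup>2" by (simp only: abs_le_square_iff)
    also have "\<dots> \<le> c\<^sup>2 / 2" by (simp add: power_divide)
    finally have small: "(Q p n)\<^sup>2 \<le> c\<^sup>2 / 2" .
    define D where "D = Q p p * Q n n - (Q p n)\<^sup>2"
    \<comment> \<open>The estimate is used with the diagonal entries in both orders, once for each
      diagonal entry of the inverse.\<close>
    note b1 = inverse_entries_bound[OF nd(2,1) c small pn]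
    note b2 = inverse_entries_bound[OF nd(1,2) c small pn]
    have D0: "D \<noteq> 0" using b1(1) c by (simp add: D_def) (smt (verit) zero_less_power)
    have Amat: "Amat \<Omega> \<delta> x $1$2 = Amat \<Omega> \<delta> x $2$1" by (rule Amat_sym)
    have QA: "Q u v = u$1 * v$1 * Amat \<Omega> \<delta> x $1$1 + (u$1 * v$2 + u$2 * v$1) * Amat \<Omega> \<delta> x $1$2 + u$2 * v$2 * Amat \<Omega> \<delta> x $2$2" for u v
      unfolding Q_def by (rule acoef_Amat[OF op \<delta>(1)])
    note inv = symmetric_2x2_inverse[OF Amat nn QA D0[unfolded D_def p_def], folded p_def, folded D_def]
    have k4: "2 / c^3 * (K * \<delta>\<^sup>2)\<^sup>2 \<le> C' * \<delta>^4"
    proof -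
      have "2 / c^3 * (K * \<delta>\<^sup>2)\<^sup>2 = (2 / c^3 * K\<^sup>2) * \<delta>^4" by (simp add: power_mult_distrib)
      also have "\<dots> \<le> C' * \<delta>^4" using C'_ge(3) by (rule mult_right_mono) simp
      finally show ?thesis .
    qed
    have k2: "2 / c\<^sup>2 * (K * \<delta>\<^sup>2) \<le> C' * \<delta>\<^sup>2" "K * \<delta>\<^sup>2 \<le> C' * \<delta>\<^sup>2"
      using mult_right_mono[OF C'_ge(2), of "\<delta>\<^sup>2"] mult_right_mono[OF C'_ge(1), of "\<delta>\<^sup>2"] by simp_all
    have "\<bar>Q n n / D - 1 / Q p p\<bar> \<le> C' * \<delta>^4" "\<bar>- Q p n / D\<bar> \<le> C' * \<delta>\<^sup>2"
      using b1(2,3) k4 k2 by (auto simp: D_def)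
    moreover have "\<bar>Q p p / D - 1 / Q n n\<bar> \<le> C' * \<delta>^4"
      using b2(2) k4 by (simp add: D_def mult.commute)
    ultimately show ?thesis
      unfolding Let_def n_def[symmetric] p_def[symmetric] Q_def[symmetric]
      using inv pn k2(2) by auto
  qed
  ultimately show ?thesis using C'0 by blast
qed

end
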